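(* Let $\mathfrak{d}$ be a delta operator on $\mathbb{C}_n[t]$, and let $\eta=(S_k)_{0\le k\le n}$ be the associated binomial curve. Denote by $a_1,\dots,a_n$ the roots of $S_n$. Let $\theta(t)=(P_k(t))_{0\le k\le n}$ where each $P_k$ is a polynomial of degree $k$, and let $C$ be the product of the leading coefficients of the $P_k$'s. Then: (i) For any $x_0,\dots,x_n\in\mathbb{C}$, $$\det(\theta(x_0),\dots,\theta(x_n))=C\prod_{i<j}(x_j-x_i).$$ (ii) For any $t\in\mathbb{C}$ (and any $v\in\mathbb{C}^{n+1}$), $$\det(\theta(t+a_1),\dots,\theta(t+a_n),v)=C\prod_{i<j}(a_j-a_i)\times n!\,W_\theta^{\mathfrak{d}}(-t,v).$$
   Context: $\mathbb{C}_n[t]$ is the space of complex polynomials of degree at most $n$. A delta operator on $\mathbb{C}_n[t]$ is a linear endomorphism $\mathfrak{d}$ commuting with all translations $P(t)\mapsto P(t+a)$, with $\mathfrak{d}(1)=0$ and $\mathfrak{d}(t)\neq 0$; equivalently $\mathfrak{d}=\sum_{k=1}^n c_k\,\partial^k/\partial t^k$ with $c_1\ne0$. Its binomial curve is $\eta=(S_k)_{0\le k\le n}$, the unique family with $\deg S_k=k$, $S_0=1$, and $\mathfrak{d}S_k=kS_{k-1}$, $S_k(0)=0$ for $1\le k\le n$. The curve $\theta(t)$ is regarded as a column vector in $\mathbb{C}^{n+1}$, and its umbral Wronskian is, for $v\in\mathbb{C}^{n+1}$, $$W_\theta^{\mathfrak{d}}(-t,v)=\frac{\det(\theta(t),\mathfrak{d}\theta(t),\dots,\mathfrak{d}^{n-1}\theta(t),v)}{\det(\theta(t),\mathfrak{d}\theta(t),\dots,\mathfrak{d}^{n-1}\theta(t),\mathfrak{d}^n\theta(t))},$$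 where $\mathfrak{d}$ acts componentwise.
   Formalization: In (ii) the right-hand side carries an extra factor c_1^n, where c_1 = d(t); the printed formula is the case c_1^n = 1 and fails otherwise, e.g. for n = 1, d = 2∂, θ = (1, t). *)

theory Defs
  imports "HOL-Computational_Algebra.Polynomial" "Jordan_Normal_Form.Determinant"
begin

text \<open>The space of complex polynomials of degree at most n. Operators on it are represented by
  functions on all of \<^typ>\<open>complex poly\<close> that are constrained on this space only.\<close>

definition polys_upto :: "nat \<Rightarrow> complex poly set" where
  "polys_upto n = {p. degree p \<le> n}"

definition translate :: "complex \<Rightarrow> complex poly \<Rightarrow> complex poly" where
  "translate a p = pcompose p [:a, 1:]"

text \<open>The condition on the image of t only makes sense if t lies in the space, i.e. \<open>1 \<le> n\<close>.\<close>

definition delta_operator :: "nat \<Rightarrow> (complex poly \<Rightarrow> complex poly) \<Rightarrow> bool" where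
  "delta_operator n d \<longleftrightarrow>
     1 \<le> n \<and>
     d \<in> polys_upto n \<rightarrow> polys_upto n \<and>
     (\<forall>p\<in>polys_upto n. \<forall>q\<in>polys_upto n. d (p + q) = d p + d q) \<and>
     (\<forall>c. \<forall>p\<in>polys_upto n. d (smult c p) = smult c (d p)) \<and>
     (\<forall>a. \<forall>p\<in>polys_upto n. d (translate a p) = translate a (d p)) \<and>
     d 1 = 0 \<and>
     d [:0, 1:] \<noteq> 0"

text \<open>In the expansion \<open>d = c\<^sub>1 \<partial> + \<dots> + c\<^sub>n \<partial>\<^sup>n\<close> the image of t is the constant
  polynomial \<open>c\<^sub>1\<close>. The power \<open>c\<^sub>1\<^sup>n\<close> is needed in the product formula over the roots of \<open>S\<^sub>n\<close>:
  \<open>S\<^sub>k\<close> has leading coefficient \<open>1 / c\<^sub>1\<^sup>k\<close> and \<open>d\<^sup>k P\<^sub>k\<close> is \<open>k! c\<^sub>1\<^sup>k\<close> times the leading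
  coefficient of \<open>P\<^sub>k\<close>. The formula without this factor is the normalised case \<open>d t = 1\<close>; it
  already fails for \<open>n = 1\<close> and \<open>d = 2 \<partial>\<close>.\<close>

definition delta_leading :: "(complex poly \<Rightarrow> complex poly) \<Rightarrow> complex" where
  "delta_leading d = coeff (d [:0, 1:]) 0"

definition binomial_curve ::
    "nat \<Rightarrow> (complex poly \<Rightarrow> complex poly) \<Rightarrow> (nat \<Rightarrow> complex poly) \<Rightarrow> bool" where
  "binomial_curve n d S \<longleftrightarrow>
     (\<forall>k\<le>n. degree (S k) = k) \<and>
     S 0 = 1 \<and>
     (\<forall>k\<in>{1..n}. d (S k) = smult (of_nat k) (S (k - 1)) \<and> poly (S k) 0 = 0)"

definition curve_at :: "nat \<Rightarrow> (nat \<Rightarrow> complex poly) \<Rightarrow> complex \<Rightarrow> complex vec" where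
  "curve_at n P t = vec (Suc n) (\<lambda>k. poly (P k) t)"

definition det_cols :: "nat \<Rightarrow> complex vec list \<Rightarrow> complex" where
  "det_cols n vs = det (mat_of_cols (Suc n) vs)"

text \<open>The defining formula gives the value at \<open>-t\<close> in terms of the curve at t, so the value at s
  uses the curve at \<open>-s\<close>.\<close>

definition umbral_wronskian ::
    "nat \<Rightarrow> (complex poly \<Rightarrow> complex poly) \<Rightarrow> (nat \<Rightarrow> complex poly) \<Rightarrow> complex \<Rightarrow> complex vec \<Rightarrow> complex"
  where
  "umbral_wronskian n d P s v =
     det_cols n (map (\<lambda>j. curve_at n (\<lambda>k. (d ^^ j) (P k)) (- s)) [0..<n] @ [v]) /
     det_cols n (map (\<lambda>j. curve_at n (\<lambda>k. (d ^^ j) (P k)) (- s)) [0..<Suc n])"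

end

theory Submission
  imports Defs
begin

text \<open>The umbral Taylor formula \<open>p(t + x) = \<Sum>j\<le>n. S\<^sub>j(x) / j! \<cdot> (d\<^sup>j p)(t)\<close> loses its term
  \<open>j = n\<close> when x is a root of \<open>S\<^sub>n\<close>. Hence the matrix with columns \<open>\<theta>(t + a\<^sub>i)\<close> and v is the
  product of the numerator matrix of the umbral Wronskian with the block diagonal matrix of
  \<open>(S\<^sub>j(a\<^sub>i) / j!)\<close> and 1, and the determinant of the first block is again a Vandermonde
  determinant. The denominator of the Wronskian is triangular because d lowers degrees by one.\<close>

section \<open>Determinants of polynomial values\<close>

lemma unitriangular_expansion:
  fixes p :: "'a :: comm_ring_1 poly"
  assumes "\<And>m. degree (Q m) \<le> m" "\<And>m. coeff (Q m) m = 1" "degree p \<le> k"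
  shows "\<exists>c. p = (\<Sum>m\<le>k. smult (c m) (Q m)) \<and> c k = coeff p k"
  using assms(3)
proof (induction k arbitrary: p)
  case 0
  have "Q 0 = 1"
    using assms(1,2)[of 0] by (metis degree_eq_zeroE le_zero_eq coeff_pCons_0 one_pCons)
  then have "p = smult (coeff p 0) (Q 0)"
    using 0 by (auto elim!: degree_eq_zeroE)
  then show ?case
    by (intro exI[of _ "\<lambda>_. coeff p 0"]) simp
next
  case (Suc k)
  let ?r = "p - smult (coeff p (Suc k)) (Q (Suc k))"
  have "degree ?r \<le> k"
  proof (rule degree_le, intro allI impI)
    fix i assume "k < i"
    then consider "i = Suc k" | "Suc k < i" by linarith
    then show "coeff ?r i = 0"
    proof cases
      case 1
      then show ?thesis by (simp add: assms(2))
    next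
      case 2
      then show ?thesis
        using Suc.prems assms(1)[of "Suc k"] by (simp add: coeff_eq_0)
    qed
  qed
  from Suc.IH[OF this] obtain c where c: "?r = (\<Sum>m\<le>k. smult (c m) (Q m))" by blast
  let ?c = "c(Suc k := coeff p (Suc k))"
  have "(\<Sum>m\<le>k. smult (?c m) (Q m)) = ?r"
    unfolding c by (intro sum.cong) auto
  then have "p = (\<Sum>m\<le>Suc k. smult (?c m) (Q m))" by simp
  then show ?case by (intro exI[of _ ?c]) simp
qed

text \<open>Expanding the \<open>P\<^sub>k\<close> in the Newton basis \<open>\<Prod>i<k. (X - x\<^sub>i)\<close> factors the matrix into a lower and an
  upper triangular one, which also evaluates the Vandermonde determinant itself.\<close>

lemma det_poly_values:
  fixes P :: "nat \<Rightarrow> 'a :: idom poly"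
  assumes deg: "\<And>k. k < n \<Longrightarrow> degree (P k) \<le> k"
  shows "det (mat n n (\<lambda>(k, i). poly (P k) (x i))) =
    (\<Prod>k<n. coeff (P k) k) * (\<Prod>j<n. \<Prod>i<j. x j - x i)"
proof -
  define Q where "Q m = (\<Prod>i<m. [:- x i, 1:])" for m
  have Qdeg: "degree (Q m) = m" for m
    unfolding Q_def by (subst degree_prod_eq_sum_degree) auto
  have Qlead: "coeff (Q m) m = 1" for m
  proof -
    have "lead_coeff (Q m) = 1" unfolding Q_def by (simp add: lead_coeff_prod)
    then show ?thesis by (simp add: Qdeg)
  qed
  have Qval: "poly (Q m) y = (\<Prod>i<m. y - x i)" for m y
    unfolding Q_def by (simp add: poly_prod)
  have "\<forall>k. \<exists>c. k < n \<longrightarrow> P k = (\<Sum>m\<le>k. smult (c m) (Q m)) \<and> c k = coeff (P k) k"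
    using unitriangular_expansion[of Q] Qdeg Qlead deg by (metis order_refl)
  then obtain c where c: "\<And>k. k < n \<Longrightarrow> P k = (\<Sum>m\<le>k. smult (c k m) (Q m))"
    "\<And>k. k < n \<Longrightarrow> c k k = coeff (P k) k" by metis
  define L where "L = mat n n (\<lambda>(k, m). if m \<le> k then c k m else 0)"
  define U where "U = mat n n (\<lambda>(m, i). poly (Q m) (x i))"
  have carr: "L \<in> carrier_mat n n" "U \<in> carrier_mat n n" by (auto simp: L_def U_def)
  have fact: "mat n n (\<lambda>(k, i). poly (P k) (x i)) = L * U"
  proof (rule eq_matI)
    fix k i assume "k < dim_row (L * U)" "i < dim_col (L * U)"
    then have ki: "k < n" "i < n" using carr by auto
    have "(L * U) $$ (k, i) = (\<Sum>m = 0..<n. (if m \<le> k then c k m else 0) * poly (Q m) (x i))"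
      using ki by (simp add: L_def U_def scalar_prod_def)
    also have "\<dots> = (\<Sum>m\<le>k. c k m * poly (Q m) (x i))"
      using ki by (intro sum.mono_neutral_cong_right) auto
    also have "\<dots> = poly (P k) (x i)"
      using ki by (subst c(1)) (simp_all add: poly_sum)
    finally show "mat n n (\<lambda>(k, i). poly (P k) (x i)) $$ (k, i) = (L * U) $$ (k, i)"
      using ki by simp
  qed (use carr in auto)
  have "det L = prod_list (diag_mat L)"
    by (rule det_lower_triangular[OF _ carr(1)]) (auto simp: L_def)
  also have "\<dots> = (\<Prod>k<n. coeff (P k) k)"
    by (simp add: prod_list_diag_prod L_def c(2) atLeast0LessThan)
  finally have L: "det L = (\<Prod>k<n. coeff (P k) k)" .
  \<comment> \<open>\<open>Q m\<close> contains the factor X - \<open>x i\<close> for every i < m,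
    so the entries below the diagonal vanish.\<close>
  have "upper_triangular U"
    unfolding U_def by (intro upper_triangularI) (auto simp: Qval)
  then have "det U = prod_list (diag_mat U)"
    by (rule det_upper_triangular[OF _ carr(2)])
  also have "\<dots> = (\<Prod>j<n. \<Prod>i<j. x j - x i)"
    by (simp add: prod_list_diag_prod U_def Qval atLeast0LessThan)
  finally have U: "det U = (\<Prod>j<n. \<Prod>i<j. x j - x i)" .
  show ?thesis
    unfolding fact det_mult[OF carr] L U ..
qed

section \<open>Delta operators\<close>

lemma poly_translate: "poly (translate a p) x = poly p (a + x)"
  by (simp add: translate_def poly_pcompose)

lemma degree_translate: "degree (translate a p) = degree p"
  by (simp add: translate_def degree_pcompose)

text \<open>Induction on coefficients: writing D for the difference of r, the difference of b + X r
  is r + D + X D. At the top degree, r contributes 1 and X D the previous factor, which yields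
  \<open>Suc m\<close>.\<close>

lemma translate_diff:
  assumes "degree p \<le> Suc m"
  shows "degree (translate 1 p - p) \<le> m"
    and "coeff (translate 1 p - p) m = of_nat (Suc m) * coeff p (Suc m)"
proof -
  have "degree (translate 1 p - p) \<le> m \<and>
      coeff (translate 1 p - p) m = of_nat (Suc m) * coeff p (Suc m)"
    using assms
  proof (induction p arbitrary: m)
    case 0
    then show ?case by (simp add: translate_def)
  next
    case (pCons b r)
    let ?D = "translate 1 r - r"
    have eq: "translate 1 (pCons b r) - pCons b r = r + ?D + pCons 0 ?D"
      by (simp add: translate_def pcompose_pCons)
    show ?case
    proof (cases m)
      case 0
      then have "degree r = 0" using pCons.prems by (auto split: if_splits)
      then obtain e where "r = [:e:]" by (auto elim: degree_eq_zeroE)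
      then show ?thesis using 0 by (simp add: translate_def pcompose_pCons)
    next
      case (Suc l)
      then have "degree r \<le> Suc l" using pCons.prems by (auto split: if_splits)
      with pCons.IH have IH: "degree ?D \<le> l" "coeff ?D l = of_nat (Suc l) * coeff r (Suc l)"
        by blast+
      have "degree (pCons 0 ?D) \<le> Suc l"
        using IH(1) degree_pCons_le le_trans Suc_le_mono by blast
      then have "degree (r + ?D + pCons 0 ?D) \<le> Suc l"
        using IH(1) \<open>degree r \<le> Suc l\<close> by (intro degree_add_le) auto
      moreover have "coeff ?D (Suc l) = 0"
        using IH(1) by (intro coeff_eq_0) simp
      then have "coeff (r + ?D + pCons 0 ?D) (Suc l) = of_nat (Suc (Suc l)) * coeff r (Suc l)"
        using IH(2) by (simp add: algebra_simps)
      ultimately show ?thesis unfolding eq Suc by simp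
    qed
  qed
  then show "degree (translate 1 p - p) \<le> m"
    "coeff (translate 1 p - p) m = of_nat (Suc m) * coeff p (Suc m)" by auto
qed

text \<open>In characteristic 0 the factor \<open>Suc m\<close> is nonzero, so a nonconstant
  polynomial loses exactly one degree. This recovers a degree bound for \<open>d p\<close> from one
  for its difference.\<close>

lemma degree_le_Suc_translate_diff: "degree p \<le> Suc (degree (translate 1 p - p))"
proof (cases "degree p")
  case (Suc m)
  then have "coeff (translate 1 p - p) m \<noteq> 0"
    using translate_diff(2)[of p m] by (metis leading_coeff_0_iff degree_0 mult_eq_0_iff
      nat.distinct(1) of_nat_eq_0_iff order_refl)
  then show ?thesis using Suc le_degree by fastforce
qed simp

section \<open>Degrees and leading coefficients under a delta operator\<close>

context
  fixes n :: nat and d :: "complex poly \<Rightarrow> complex poly"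
  assumes delta: "delta_operator n d"
begin

lemma delta_degree_upto: "degree p \<le> n \<Longrightarrow> degree (d p) \<le> n"
  using delta by (auto simp: delta_operator_def polys_upto_def)

lemma delta_add: "degree p \<le> n \<Longrightarrow> degree q \<le> n \<Longrightarrow> d (p + q) = d p + d q"
  using delta by (auto simp: delta_operator_def polys_upto_def)

lemma delta_smult: "degree p \<le> n \<Longrightarrow> d (smult c p) = smult c (d p)"
  using delta by (auto simp: delta_operator_def polys_upto_def)

lemma delta_translate: "degree p \<le> n \<Longrightarrow> d (translate a p) = translate a (d p)"
  using delta by (auto simp: delta_operator_def polys_upto_def)

lemma delta_0: "d 0 = 0"
  using delta_smult[of 0 0] by simp

lemma delta_const: "degree p = 0 \<Longrightarrow> d p = 0"
proof -
  have "d [:c:] = 0" for c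
    using delta_smult[of 1 c] delta by (simp add: delta_operator_def one_pCons)
  then show "degree p = 0 \<Longrightarrow> d p = 0" by (auto elim: degree_eq_zeroE)
qed

lemma delta_diff: "degree p \<le> n \<Longrightarrow> degree q \<le> n \<Longrightarrow> d (p - q) = d p - d q"
  using delta_add[of p "smult (-1) q"] delta_smult[of q "-1"] by simp

lemma delta_sum:
  assumes "finite A" "\<And>j. j \<in> A \<Longrightarrow> degree (f j) \<le> n"
  shows "d (\<Sum>j\<in>A. smult (c j) (f j)) = (\<Sum>j\<in>A. smult (c j) (d (f j)))"
  using assms
proof (induction A rule: finite_induct)
  case (insert j A)
  have "degree (\<Sum>j\<in>A. smult (c j) (f j)) \<le> n"
    by (intro degree_sum_le insert) (auto intro: order.trans[OF degree_smult_le] insert)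
  moreover have "degree (smult (c j) (f j)) \<le> n"
    using insert.prems by (meson insertI1 degree_smult_le order.trans)
  ultimately show ?case
    using insert by (simp add: delta_add delta_smult)
qed (simp add: delta_0)

lemma delta_X: "d [:0, 1:] = [:delta_leading d:]" and delta_leading_nonzero: "delta_leading d \<noteq> 0"
proof -
  have n: "1 \<le> n" and nz: "d [:0, 1:] \<noteq> 0" using delta by (auto simp: delta_operator_def)
  \<comment> \<open>Since d kills the added 1, the image of t is invariant under translation by 1.
    Its difference is zero, which forces it to be constant.\<close>
  have "translate 1 [:0, 1:] = [:0, 1:] + 1"
    by (simp add: translate_def pcompose_pCons one_pCons)
  then have "translate 1 (d [:0, 1:]) = d [:0, 1:]"
    using n delta_translate[of "[:0, 1:]" 1] by (simp add: delta_add delta_const)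
  then have "degree (d [:0, 1:]) \<le> 1" and "coeff (d [:0, 1:]) 1 = 0"
    using degree_le_Suc_translate_diff[of "d [:0, 1:]"] translate_diff(2)[of "d [:0, 1:]" 0] by auto
  then have "degree (d [:0, 1:]) = 0"
    by (metis degree_0 le_neq_implies_less leading_coeff_0_iff less_one)
  then show "d [:0, 1:] = [:delta_leading d:]"
    unfolding delta_leading_def by (metis degree_eq_zeroE coeff_pCons_0)
  with nz show "delta_leading d \<noteq> 0" by auto
qed

text \<open>Induction on the degree: \<open>d\<close> commutes with the difference \<open>p(t + 1) - p(t)\<close>, which lowers
  the degree by exactly one and multiplies the top coefficient by the degree.\<close>

lemma delta_lowers_degree:
  assumes "degree p \<le> Suc k" "Suc k \<le> n"
  shows "degree (d p) \<le> k"
    and "coeff (d p) k = delta_leading d * of_nat (Suc k) * coeff p (Suc k)"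
proof -
  have "degree (d p) \<le> k \<and> coeff (d p) k = delta_leading d * of_nat (Suc k) * coeff p (Suc k)"
    using assms
  proof (induction k arbitrary: p)
    case 0
    then obtain b e where p: "p = [:b, e:]"
      by (metis One_nat_def degree1_coeffs degree_eq_zeroE le_Suc_eq le_zero_eq pCons_0_0)
    have "d p = d ([:b:] + smult e [:0, 1:])" by (simp add: p)
    also have "\<dots> = smult e [:delta_leading d:]"
      using 0 by (subst delta_add) (simp_all add: delta_smult delta_const delta_X del: smult_pCons)
    finally show ?case by (simp add: p)
  next
    case (Suc k)
    let ?q = "translate 1 p - p"
    have q: "degree ?q \<le> Suc k" "coeff ?q (Suc k) = of_nat (Suc (Suc k)) * coeff p (Suc (Suc k))"
      using translate_diff[OF Suc.prems(1)] by auto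
    have dq: "d ?q = translate 1 (d p) - d p"
      using Suc.prems by (simp add: delta_diff delta_translate degree_translate)
    have IH: "degree (d ?q) \<le> k" "coeff (d ?q) k = delta_leading d * of_nat (Suc k) * coeff ?q (Suc k)"
      using Suc.IH[OF q(1)] Suc.prems by auto
    have deg: "degree (d p) \<le> Suc k"
      using degree_le_Suc_translate_diff[of "d p"] IH(1) unfolding dq by linarith
    \<comment> \<open>The coefficient of degree k in \<open>d ?q\<close> is computed twice: as that
      of the difference of \<open>d p\<close>, and by the induction hypothesis. Both values carry
      the factor \<open>Suc k\<close>, which cancels.\<close>
    have "of_nat (Suc k) * coeff (d p) (Suc k) =
        of_nat (Suc k) * (delta_leading d * of_nat (Suc (Suc k)) * coeff p (Suc (Suc k)))"
      using translate_diff(2)[OF deg] IH(2) unfolding dq q(2) by (simp only: mult_ac)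
    moreover have "of_nat (Suc k) \<noteq> (0 :: complex)" using of_nat_neq_0 .
    ultimately show ?case using deg by (metis mult_left_cancel)
  qed
  then show "degree (d p) \<le> k"
    "coeff (d p) k = delta_leading d * of_nat (Suc k) * coeff p (Suc k)" by auto
qed

text \<open>For degree k + 1 the coefficient of degree k in \<open>d p\<close> would be a product of
  nonzero factors. Hence d determines a polynomial up to a constant.\<close>

lemma delta_kernel:
  assumes "degree p \<le> n" "d p = 0"
  shows "degree p = 0"
proof (cases "degree p")
  case (Suc k)
  then have "coeff p (Suc k) = 0"
    using delta_lowers_degree(2)[of p k] assms delta_leading_nonzero of_nat_neq_0[of k, where ?'a = complex]
    by simp
  then show ?thesis using Suc by (metis leading_coeff_0_iff degree_0)
qed

text \<open>Each application multiplies the top coefficient by \<open>delta_leading d\<close> and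
  the current degree. These constants are the diagonal of the Wronskian denominator.\<close>

lemma delta_funpow_degree:
  assumes "degree p \<le> m" "m \<le> n"
  shows "(d ^^ m) p = [:delta_leading d ^ m * fact m * coeff p m:]"
  using assms
proof (induction m arbitrary: p)
  case 0
  then show ?case by (auto elim!: degree_eq_zeroE)
next
  case (Suc m)
  then show ?case
    using delta_lowers_degree[of p m]
    by (simp add: funpow_Suc_right mult_ac del: funpow.simps)
qed

lemma delta_funpow_eq_0:
  assumes "degree p < j" "degree p \<le> n"
  shows "(d ^^ j) p = 0"
proof -
  \<comment> \<open>The first \<open>Suc (degree p)\<close> applications reach a constant and then
    0; the remaining i preserve 0.\<close>
  obtain i where i: "j = i + Suc (degree p)"
    using assms(1) by (metis add.commute less_imp_Suc_add add_Suc_right)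
  have zero: "(d ^^ i) 0 = 0" by (induction i) (simp_all add: delta_0)
  have "(d ^^ Suc (degree p)) p = 0"
    using assms(2) by (simp add: delta_funpow_degree delta_const)
  then show ?thesis unfolding i by (simp only: funpow_add o_apply zero)
qed

lemma delta_funpow_degree_upto: "degree p \<le> n \<Longrightarrow> degree ((d ^^ j) p) \<le> n"
  by (induction j) (simp_all add: delta_degree_upto)

lemma delta_funpow_translate:
  "degree p \<le> n \<Longrightarrow> (d ^^ j) (translate a p) = translate a ((d ^^ j) p)"
  by (induction j) (simp_all add: delta_translate delta_funpow_degree_upto)

section \<open>Binomial curves and the umbral Taylor formula\<close>

context
  fixes S :: "nat \<Rightarrow> complex poly"
  assumes binomial: "binomial_curve n d S"
begin

lemma binomial_curve_degree: "k \<le> n \<Longrightarrow> degree (S k) = k"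
  and binomial_curve_0: "S 0 = 1"
  and delta_binomial_curve: "Suc k \<le> n \<Longrightarrow> d (S (Suc k)) = smult (of_nat (Suc k)) (S k)"
  and binomial_curve_at_0: "Suc k \<le> n \<Longrightarrow> poly (S (Suc k)) 0 = 0"
  using binomial by (auto simp: binomial_curve_def Ball_def)

text \<open>Compare the coefficients of degree k in the recursion for
  \<open>d (S (Suc k))\<close>.\<close>

lemma binomial_curve_lead: "k \<le> n \<Longrightarrow> coeff (S k) k * delta_leading d ^ k = 1"
proof (induction k)
  case 0
  then show ?case by (simp add: binomial_curve_0)
next
  case (Suc k)
  have "of_nat (Suc k) * coeff (S k) k = of_nat (Suc k) * (delta_leading d * coeff (S (Suc k)) (Suc k))"
    using delta_lowers_degree(2)[of "S (Suc k)" k] Suc.prems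
    by (simp add: binomial_curve_degree delta_binomial_curve mult_ac del: of_nat_Suc)
  then have "coeff (S k) k = delta_leading d * coeff (S (Suc k)) (Suc k)"
    using of_nat_neq_0[of k, where ?'a = complex] by (metis mult_left_cancel)
  then show ?case using Suc by (simp add: mult_ac)
qed

text \<open>Induction on the degree bound m, with the range of summation fixed at n. By the
  hypothesis for \<open>d p\<close>, d sends both sides to the same polynomial, so they differ by a
  constant, which is 0 by evaluation at 0.\<close>

lemma umbral_taylor_at_0:
  assumes "degree p \<le> m" "m \<le> n"
  shows "p = (\<Sum>j\<le>n. smult (poly ((d ^^ j) p) 0 / fact j) (S j))"
  using assms
proof (induction m arbitrary: p)
  case 0
  then have "(\<Sum>j\<le>n. smult (poly ((d ^^ j) p) 0 / fact j) (S j)) =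
      (\<Sum>j\<in>{0}. smult (poly ((d ^^ j) p) 0 / fact j) (S j))"
    by (intro sum.mono_neutral_right) (auto simp: delta_funpow_eq_0)
  also have "\<dots> = p"
    using 0 by (auto simp: binomial_curve_0 elim!: degree_eq_zeroE)
  finally show ?case ..
next
  case (Suc m)
  define q where "q = (\<Sum>j\<le>n. smult (poly ((d ^^ j) p) 0 / fact j) (S j))"
  have n: "n = Suc (n - 1)" using Suc.prems by simp
  have degp: "degree p \<le> n" using Suc.prems by simp
  have degq: "degree q \<le> n"
    unfolding q_def
    by (intro degree_sum_le) (auto intro: order.trans[OF degree_smult_le] simp: binomial_curve_degree)
  have degdp: "degree (d p) \<le> m" using delta_lowers_degree(1) Suc.prems by blast
  have "d q = (\<Sum>j\<le>n. smult (poly ((d ^^ j) p) 0 / fact j) (d (S j)))"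
    unfolding q_def by (rule delta_sum) (auto simp: binomial_curve_degree)
  also have "\<dots> = (\<Sum>j\<le>n - 1. smult (poly ((d ^^ Suc j) p) 0 / fact (Suc j)) (d (S (Suc j))))"
    by (subst n, subst sum.atMost_Suc_shift) (simp add: binomial_curve_0 delta_const)
  also have "\<dots> = (\<Sum>j\<le>n - 1. smult (poly ((d ^^ j) (d p)) 0 / fact j) (S j))"
  proof (rule sum.cong)
    fix j assume "j \<in> {..n - 1}"
    then have "Suc j \<le> n" using n by auto
    moreover have "of_nat (Suc j) \<noteq> (0 :: complex)" using of_nat_neq_0 .
    ultimately show "smult (poly ((d ^^ Suc j) p) 0 / fact (Suc j)) (d (S (Suc j))) =
        smult (poly ((d ^^ j) (d p)) 0 / fact j) (S j)"
      by (simp add: delta_binomial_curve funpow_swap1 fact_Suc divide_simps del: of_nat_Suc)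
  qed simp
  \<comment> \<open>The term j = n restored here is zero, since \<open>d p\<close> has degree at
    most m < n.\<close>
  also have "\<dots> = (\<Sum>j\<le>n. smult (poly ((d ^^ j) (d p)) 0 / fact j) (S j))"
    using degdp Suc.prems by (intro sum.mono_neutral_left) (auto simp: delta_funpow_eq_0)
  also have "\<dots> = d p"
    using Suc.IH[OF degdp] Suc.prems by simp
  finally have "d (q - p) = 0" using degp degq by (simp add: delta_diff)
  then have "degree (q - p) = 0"
    using degp degq by (intro delta_kernel degree_diff_le)
  then obtain e where e: "q - p = [:e:]" by (auto elim: degree_eq_zeroE)
  \<comment> \<open>At 0 only \<open>S 0\<close> = 1 survives, with coefficient
    \<open>poly p 0\<close>.\<close>
  have "poly q 0 = poly p 0"
    unfolding q_def poly_sum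
    by (subst n, subst sum.atMost_Suc_shift) (use n in \<open>auto simp: binomial_curve_0 binomial_curve_at_0 intro!: sum.neutral\<close>)
  then have "e = 0" using arg_cong[OF e, of "\<lambda>r. poly r 0"] by simp
  then show ?case using e unfolding q_def by simp
qed

text \<open>The expansion at 0 is applied to the translate of p by t, with which the powers of d
  commute.\<close>

lemma umbral_taylor:
  assumes "degree p \<le> n"
  shows "poly p (t + x) = (\<Sum>j\<le>n. poly ((d ^^ j) p) t * (poly (S j) x / fact j))"
proof -
  have "poly p (t + x) = poly (translate t p) x" by (simp add: poly_translate)
  also have "\<dots> = poly (\<Sum>j\<le>n. smult (poly ((d ^^ j) (translate t p)) 0 / fact j) (S j)) x"
    using umbral_taylor_at_0[of "translate t p" n] assms by (simp add: degree_translate)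
  also have "\<dots> = (\<Sum>j\<le>n. poly ((d ^^ j) p) t * (poly (S j) x / fact j))"
    using assms by (simp add: poly_sum delta_funpow_translate poly_translate)
  finally show ?thesis .
qed

end

section \<open>The denominator of the umbral Wronskian\<close>

lemma det_umbral_wronskian_columns:
  assumes "\<And>k. k \<le> n \<Longrightarrow> degree (P k) \<le> k"
  shows "det_cols n (map (\<lambda>j. curve_at n (\<lambda>k. (d ^^ j) (P k)) t) [0..<Suc n]) =
    (\<Prod>k\<le>n. delta_leading d ^ k * fact k * coeff (P k) k)"
proof -
  define M where "M = mat (Suc n) (Suc n) (\<lambda>(k, j). poly ((d ^^ j) (P k)) t)"
  have M: "M \<in> carrier_mat (Suc n) (Suc n)" by (simp add: M_def)
  have eq: "mat_of_cols (Suc n) (map (\<lambda>j. curve_at n (\<lambda>k. (d ^^ j) (P k)) t) [0..<Suc n]) = M"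
    by (rule eq_matI) (auto simp: M_def mat_of_cols_index curve_at_def simp del: upt_Suc)
  \<comment> \<open>Entries right of the diagonal vanish, and those on it are constant polynomials,
    so the determinant does not depend on t.\<close>
  have "(d ^^ j) (P k) = 0" if "k < j" "j < Suc n" for k j
    using assms[of k] that by (intro delta_funpow_eq_0) auto
  then have "det M = prod_list (diag_mat M)"
    by (intro det_lower_triangular[OF _ M]) (auto simp: M_def)
  also have "\<dots> = (\<Prod>k = 0..<Suc n. poly ((d ^^ k) (P k)) t)"
    by (simp add: prod_list_diag_prod M_def)
  also have "\<dots> = (\<Prod>k\<le>n. delta_leading d ^ k * fact k * coeff (P k) k)"
    by (intro prod.cong) (auto simp: delta_funpow_degree assms)
  finally show ?thesis unfolding det_cols_def eq .
qed

end

section \<open>Determinants of curve points and the product formula over the roots of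
  \<open>S n\<close>\<close>

theorem theorem1p2:
  fixes n :: nat
    and d :: "complex poly \<Rightarrow> complex poly"
    and S P :: "nat \<Rightarrow> complex poly"
    and a :: "nat \<Rightarrow> complex"
    and C :: complex
  assumes "delta_operator n d"
    and "binomial_curve n d S"
    and "image_mset a (mset_set {1..n}) = proots (S n)"
    and "\<forall>k\<le>n. P k \<noteq> 0 \<and> degree (P k) = k"
    and "C = (\<Prod>k\<le>n. lead_coeff (P k))"
  shows "(\<forall>x :: nat \<Rightarrow> complex.
            det_cols n (map (\<lambda>i. curve_at n P (x i)) [0..<Suc n]) =
              C * (\<Prod>j\<in>{0..n}. \<Prod>i\<in>{0..<j}. x j - x i)) \<and>
         (\<forall>t. \<forall>v\<in>carrier_vec (Suc n).
            det_cols n (map (\<lambda>i. curve_at n P (t + a i)) [1..<Suc n] @ [v]) =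
              C * (\<Prod>j\<in>{1..n}. \<Prod>i\<in>{1..<j}. a j - a i) *
                (fact n * delta_leading d ^ n * umbral_wronskian n d P (- t) v))"
proof (intro conjI allI ballI)
  have degP: "degree (P k) \<le> k" if "k \<le> n" for k using assms(4) that by simp
  have C: "C = (\<Prod>k\<le>n. coeff (P k) k)" unfolding assms(5) using assms(4) by simp
  {
    fix x :: "nat \<Rightarrow> complex"
    have "mat_of_cols (Suc n) (map (\<lambda>i. curve_at n P (x i)) [0..<Suc n]) =
        mat (Suc n) (Suc n) (\<lambda>(k, i). poly (P k) (x i))"
      by (rule eq_matI) (auto simp: mat_of_cols_index curve_at_def simp del: upt_Suc)
    then show "det_cols n (map (\<lambda>i. curve_at n P (x i)) [0..<Suc n]) =
        C * (\<Prod>j\<in>{0..n}. \<Prod>i\<in>{0..<j}. x j - x i)"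
      using det_poly_values[of "Suc n" P x] degP
      by (simp add: det_cols_def C lessThan_Suc_atMost atLeast0AtMost atLeast0LessThan
          del: prod.lessThan_Suc)
  }
  fix t :: complex and v :: "complex vec"
  assume v: "v \<in> carrier_vec (Suc n)"
  let ?c = "delta_leading d"
  define V where "V = (\<Prod>j\<in>{1..n}. \<Prod>i\<in>{1..<j}. a j - a i)"
  define W where "W = mat_of_cols (Suc n) (map (\<lambda>j. curve_at n (\<lambda>k. (d ^^ j) (P k)) t) [0..<n] @ [v])"
  define A where "A = mat_of_cols (Suc n) (map (\<lambda>i. curve_at n P (t + a i)) [1..<Suc n] @ [v])"
  \<comment> \<open>Columns count from 0 but roots from 1, hence \<open>Suc i\<close>. The factor
    1/j! sits inside the polynomial so that \<open>det_poly_values\<close> applies to B.\<close>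
  define B where "B = mat n n (\<lambda>(j, i). poly (smult (1 / fact j) (S j)) (a (Suc i)))"
  define B' where "B' = four_block_mat B (0\<^sub>m n 1) (0\<^sub>m 1 n) (1\<^sub>m 1)"
  have Bc: "B \<in> carrier_mat n n" by (simp add: B_def)
  have B'c: "B' \<in> carrier_mat (Suc n) (Suc n)"
    unfolding B'_def using four_block_carrier_mat[OF Bc, of "1\<^sub>m 1" 1 1] by simp
  have Wc: "W \<in> carrier_mat (Suc n) (Suc n)"
    unfolding W_def using mat_of_cols_carrier(1)[of "Suc n" "map (\<lambda>j. curve_at n (\<lambda>k. (d ^^ j) (P k)) t) [0..<n] @ [v]"]
    by simp
  have Ac: "A \<in> carrier_mat (Suc n) (Suc n)"
    unfolding A_def using mat_of_cols_carrier(1)[of "Suc n" "map (\<lambda>i. curve_at n P (t + a i)) [1..<Suc n] @ [v]"]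
    by (simp del: upt_Suc)
  have root: "poly (S n) (a (Suc i)) = 0" if "i < n" for i
  proof -
    have "a (Suc i) \<in># image_mset a (mset_set {1..n})" using that by simp
    then show ?thesis
      unfolding assms(3) using assms(2) by (cases "S n = 0") auto
  qed
  have "A = W * B'"
  proof (rule eq_matI)
    fix k i assume "k < dim_row (W * B')" "i < dim_col (W * B')"
    then have k: "k < Suc n" and i: "i < Suc n" using Wc B'c by auto
    have prod: "(W * B') $$ (k, i) = (\<Sum>j<n. W $$ (k, j) * B' $$ (j, i)) + W $$ (k, n) * B' $$ (n, i)"
      using k i Wc B'c by (simp add: scalar_prod_def atLeast0LessThan)
    have Wn: "W $$ (k, n) = v $ k"
      using k by (simp add: W_def mat_of_cols_index nth_append)
    show "A $$ (k, i) = (W * B') $$ (k, i)"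
    proof (cases "i < n")
      case True
      have "A $$ (k, i) = poly (P k) (t + a (Suc i))"
        using k i True by (simp add: A_def mat_of_cols_index nth_append curve_at_def del: upt_Suc)
      also have "\<dots> = (\<Sum>j<Suc n. poly ((d ^^ j) (P k)) t * (poly (S j) (a (Suc i)) / fact j))"
        using k degP[of k] by (subst umbral_taylor[OF assms(1,2)]) (auto simp: lessThan_Suc_atMost)
      \<comment> \<open>The Taylor term j = n drops out because \<open>a (Suc i)\<close> is a root
        of \<open>S n\<close>; only the columns j < n of W remain.\<close>
      also have "\<dots> = (\<Sum>j<n. poly ((d ^^ j) (P k)) t * (poly (S j) (a (Suc i)) / fact j))"
        using root[OF True] by simp
      also have "\<dots> = (\<Sum>j<n. W $$ (k, j) * B' $$ (j, i))"
        using k True by (intro sum.cong)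
          (auto simp: W_def B'_def B_def mat_of_cols_index nth_append curve_at_def)
      also have "\<dots> = (W * B') $$ (k, i)"
        unfolding prod using True Bc by (simp add: B'_def)
      finally show ?thesis .
    next
      case False
      then have "i = n" using i by simp
      then have "A $$ (k, i) = v $ k"
        using k by (simp add: A_def mat_of_cols_index nth_append del: upt_Suc)
      \<comment> \<open>The last column of \<open>B'\<close> is a unit vector and copies v.\<close>
      also have "\<dots> = (W * B') $$ (k, i)"
        unfolding prod Wn using \<open>i = n\<close> Bc by (simp add: B'_def)
      finally show ?thesis .
    qed
  qed (use Ac Wc B'c in auto)
  then have detA: "det A = det W * det B'" using det_mult[OF Wc B'c] by simp
  have "det B' = det B"
    unfolding B'_def using det_four_block_mat_lower_left_zero[OF Bc, of "0\<^sub>m n 1" 1 "0\<^sub>m 1 n" "1\<^sub>m 1"]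
    by simp
  also have "\<dots> = (\<Prod>k<n. coeff (S k) k / fact k) * (\<Prod>j<n. \<Prod>i<j. a (Suc j) - a (Suc i))"
    unfolding B_def
    by (subst det_poly_values) (use assms(2) in \<open>auto simp: binomial_curve_def\<close>)
  also have "(\<Prod>j<n. \<Prod>i<j. a (Suc j) - a (Suc i)) = V"
  proof -
    have inner: "(\<Prod>i\<in>{1..<Suc j}. a (Suc j) - a i) = (\<Prod>i<j. a (Suc j) - a (Suc i))" for j
      unfolding One_nat_def prod.shift_bounds_Suc_ivl atLeast0LessThan ..
    have "V = (\<Prod>j\<in>{Suc 0..<Suc n}. \<Prod>i\<in>{1..<j}. a j - a i)"
      unfolding V_def atLeastLessThanSuc_atLeastAtMost by simp
    also have "\<dots> = (\<Prod>j<n. \<Prod>i<j. a (Suc j) - a (Suc i))"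
      unfolding prod.shift_bounds_Suc_ivl inner atLeast0LessThan ..
    finally show ?thesis ..
  qed
  finally have detB': "det B' = (\<Prod>k<n. coeff (S k) k / fact k) * V" .
  define D where "D = (\<Prod>k\<le>n. ?c ^ k * fact k * coeff (P k) k)"
  have c0: "?c \<noteq> 0" by (rule delta_leading_nonzero[OF assms(1)])
  have "coeff (P k) k \<noteq> 0" if "k \<le> n" for k
    using assms(4) that by (metis leading_coeff_0_iff)
  \<comment> \<open>D is the denominator of the Wronskian, so the quotient is a genuine division
    rather than the default value 0.\<close>
  then have D0: "D \<noteq> 0" unfolding D_def using c0 by simp
  have W: "umbral_wronskian n d P (- t) v = det W / D"
  proof -
    have "det_cols n (map (\<lambda>j. curve_at n (\<lambda>k. (d ^^ j) (P k)) t) [0..<Suc n]) = D"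
      unfolding D_def by (rule det_umbral_wronskian_columns[OF assms(1)]) (rule degP)
    then show ?thesis
      unfolding umbral_wronskian_def minus_minus by (simp only: W_def det_cols_def)
  qed
  \<comment> \<open>The leading coefficient of \<open>S k\<close> is the inverse of
    \<open>?c ^ k\<close>, and the factorials cancel.\<close>
  have lead: "(\<Prod>k<n. coeff (S k) k / fact k) * (\<Prod>k<n. ?c ^ k * fact k) = 1"
    unfolding prod.distrib[symmetric]
    by (rule prod.neutral) (use binomial_curve_lead[OF assms(1,2)] in auto)
  have "D = C * (\<Prod>k\<le>n. ?c ^ k * fact k)"
    unfolding D_def C by (simp add: prod.distrib mult_ac)
  \<comment> \<open>B has only n rows, so its determinant cancels the factors k < n of D. The factor
    k = n is left over and gives \<open>fact n * ?c ^ n\<close>.\<close>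
  also have "(\<Prod>k\<le>n. ?c ^ k * fact k) = (\<Prod>k<n. ?c ^ k * fact k) * (?c ^ n * fact n)"
    unfolding lessThan_Suc_atMost[symmetric] by simp
  finally have "(\<Prod>k<n. coeff (S k) k / fact k) * D =
      ((\<Prod>k<n. coeff (S k) k / fact k) * (\<Prod>k<n. ?c ^ k * fact k)) * (C * ?c ^ n * fact n)"
    by (simp only: mult_ac)
  then have SD: "(\<Prod>k<n. coeff (S k) k / fact k) * D = C * ?c ^ n * fact n"
    unfolding lead by simp
  have "det A = (\<Prod>k<n. coeff (S k) k / fact k) * D * V * (det W / D)"
    unfolding detA detB' using D0 by simp
  also have "\<dots> = C * V * (fact n * ?c ^ n * (det W / D))"
    unfolding SD by (simp only: mult_ac)
  finally show "det_cols n (map (\<lambda>i. curve_at n P (t + a i)) [1..<Suc n] @ [v]) =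
      C * (\<Prod>j\<in>{1..n}. \<Prod>i\<in>{1..<j}. a j - a i) *
        (fact n * ?c ^ n * umbral_wronskian n d P (- t) v)"
    unfolding W V_def[symmetric] det_cols_def A_def[symmetric] .
qed

end
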